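(* Let $G=(V,E)$ be a finite simple undirected graph that is $4$-sparse, and let $a,b:V\to\mathbb{N}_{\ge 2}$ be functions such that $d(x)\ge a(x)+b(x)$ for every vertex $x\in V$. Then $G$ has an $(a,b)$-internal partition, i.e., a partition $V=A\cup B$ into two disjoint non-empty sets $A,B$ such that $d_A(x)\ge a(x)$ for every $x\in A$ and $d_B(x)\ge b(x)$ for every $x\in B$.
   Context: $d(x)$ is the degree of $x$ and $d_S(x)=|N(x)\cap S|$ is the number of neighbors of $x$ in $S\subseteq V$. $\mathbb{N}_{\ge 2}=\{2,3,\dots\}$. A graph is $4$-sparse if every set of four vertices spans at most four edges. Partitions are required to be non-trivial: both parts non-empty. *)

theory Defs
  imports Main
begin

definition fin_simple_graph :: "'a set \<Rightarrow> 'a set set \<Rightarrow> bool" where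
  "fin_simple_graph V E \<longleftrightarrow> finite V \<and> (\<forall>e\<in>E. e \<subseteq> V \<and> card e = 2)"

definition neighborhood :: "'a set set \<Rightarrow> 'a \<Rightarrow> 'a set" where
  "neighborhood E x = {y. {x, y} \<in> E}"

definition degree :: "'a set set \<Rightarrow> 'a \<Rightarrow> nat" where
  "degree E x = card (neighborhood E x)"

definition degree_in :: "'a set set \<Rightarrow> 'a set \<Rightarrow> 'a \<Rightarrow> nat" where
  "degree_in E S x = card (neighborhood E x \<inter> S)"

definition four_sparse :: "'a set \<Rightarrow> 'a set set \<Rightarrow> bool" where
  "four_sparse V E \<longleftrightarrow> (\<forall>S\<subseteq>V. card S = 4 \<longrightarrow> card {e \<in> E. e \<subseteq> S} \<le> 4)"

definition internal_partition ::
  "'a set \<Rightarrow> 'a set set \<Rightarrow> ('a \<Rightarrow> nat) \<Rightarrow> ('a \<Rightarrow> nat) \<Rightarrow> 'a set \<Rightarrow> 'a set \<Rightarrow> bool" where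
  "internal_partition V E a b A B \<longleftrightarrow>
     A \<union> B = V \<and> A \<inter> B = {} \<and> A \<noteq> {} \<and> B \<noteq> {} \<and>
     (\<forall>x\<in>A. a x \<le> degree_in E A x) \<and>
     (\<forall>x\<in>B. b x \<le> degree_in E B x)"

end

theory Submission
  imports Defs
begin

text \<open>
  Suppose that no two disjoint non-empty sets are \<open>a\<close>-good and \<open>b\<close>-good; otherwise take the
  first set as large as possible, and its complement is \<open>b\<close>-good. Among the partitions of \<open>V\<close> into a set \<open>A\<close> without \<open>(a + 1)\<close>-good
  part and a set \<open>B\<close> without \<open>(b + 1)\<close>-good part, maximise \<open>e(A) + e(B) + b(A) + a(B)\<close>; by symmetry
  \<open>B\<close> has no \<open>b\<close>-good part, and then let \<open>A\<close> be as small as possible. Some \<open>x \<in> A\<close> has at most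
  \<open>a(x)\<close> neighbours in \<open>A\<close>; moving it to \<open>B\<close> keeps the weight maximal and creates a \<open>b\<close>-good part,
  so \<open>A - x\<close> has no \<open>a\<close>-good part. A vertex \<open>y \<in> B\<close> of degree less than \<open>b(y)\<close> in \<open>B\<close> and a vertex
  \<open>z \<in> A - x\<close> of degree less than \<open>a(z)\<close> in \<open>A - x\<close> cannot be moved without losing admissibility,
  which forces a triangle \<open>x y z\<close>. Since \<open>b(y) \<ge> 2\<close>, the set \<open>B - y\<close> is non-empty and the next
  vertex of small degree in it is adjacent to two vertices of the triangle, contradicting 4-sparsity.
\<close>

section \<open>Good, degenerate and admissible sets\<close>

definition good :: "'a set set \<Rightarrow> ('a \<Rightarrow> nat) \<Rightarrow> 'a set \<Rightarrow> bool" where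
  "good E f S \<longleftrightarrow> (\<forall>x\<in>S. f x \<le> degree_in E S x)"

definition degenerate :: "'a set set \<Rightarrow> ('a \<Rightarrow> nat) \<Rightarrow> 'a set \<Rightarrow> bool" where
  "degenerate E f S \<longleftrightarrow> (\<forall>T\<subseteq>S. T \<noteq> {} \<longrightarrow> \<not> good E f T)"

definition no_good_pair ::
  "'a set \<Rightarrow> 'a set set \<Rightarrow> ('a \<Rightarrow> nat) \<Rightarrow> ('a \<Rightarrow> nat) \<Rightarrow> bool" where
  "no_good_pair V E a b \<longleftrightarrow>
     (\<forall>S T. S \<subseteq> V \<and> T \<subseteq> V \<and> S \<inter> T = {} \<and> S \<noteq> {} \<and> T \<noteq> {} \<longrightarrow> \<not> (good E a S \<and> good E b T))"

text \<open>The slack of one in both thresholds lets a single vertex enter a side that is degenerate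
  for the original threshold; see \<open>degenerate_insert\<close>. Non-emptiness of the sides is
  derived later.\<close>

definition admissible ::
  "'a set \<Rightarrow> 'a set set \<Rightarrow> ('a \<Rightarrow> nat) \<Rightarrow> ('a \<Rightarrow> nat) \<Rightarrow> 'a set \<Rightarrow> 'a set \<Rightarrow> bool" where
  "admissible V E a b A B \<longleftrightarrow> A \<union> B = V \<and> A \<inter> B = {} \<and>
     degenerate E (\<lambda>x. Suc (a x)) A \<and> degenerate E (\<lambda>x. Suc (b x)) B"

definition edges_in :: "'a set set \<Rightarrow> 'a set \<Rightarrow> nat" where
  "edges_in E S = card {e \<in> E. e \<subseteq> S}"

text \<open>The sums are crosswise so that moving \<open>x\<close> from \<open>A\<close> to
  \<open>B\<close> changes the weight by its surplus \<open>degree_in E B x - b x\<close> minus its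
  surplus \<open>degree_in E A x - a x\<close>.\<close>

definition weight ::
  "'a set set \<Rightarrow> ('a \<Rightarrow> nat) \<Rightarrow> ('a \<Rightarrow> nat) \<Rightarrow> 'a set \<Rightarrow> 'a set \<Rightarrow> nat" where
  "weight E a b A B = edges_in E A + edges_in E B + sum b A + sum a B"

section \<open>Neighbourhoods, degrees and the weight of a move\<close>

lemma neighborhood_sym: "y \<in> neighborhood E x \<longleftrightarrow> x \<in> neighborhood E y"
  by (simp add: neighborhood_def insert_commute)

lemma not_neighbor_self: "fin_simple_graph V E \<Longrightarrow> x \<notin> neighborhood E x"
  by (force simp: neighborhood_def fin_simple_graph_def)

lemma neighborhood_subset: "fin_simple_graph V E \<Longrightarrow> neighborhood E x \<subseteq> V"
  by (auto simp: neighborhood_def fin_simple_graph_def)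

lemma finite_neighborhood: "fin_simple_graph V E \<Longrightarrow> finite (neighborhood E x)"
  by (meson neighborhood_subset fin_simple_graph_def finite_subset)

lemma finite_edges: "fin_simple_graph V E \<Longrightarrow> finite E"
  by (rule finite_subset[of _ "Pow V"]) (auto simp: fin_simple_graph_def)

lemma degree_in_mono:
  "fin_simple_graph V E \<Longrightarrow> S \<subseteq> T \<Longrightarrow> degree_in E S x \<le> degree_in E T x"
  unfolding degree_in_def by (intro card_mono) (auto dest: finite_neighborhood)

lemma degree_in_insert:
  assumes "fin_simple_graph V E" "v \<notin> S"
  shows "degree_in E (insert v S) x = degree_in E S x + (if v \<in> neighborhood E x then 1 else 0)"
  using assms finite_neighborhood[OF assms(1), of x]
  by (auto simp: degree_in_def Int_insert_right)

lemma degree_in_partition: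
  assumes "fin_simple_graph V E" "A \<union> B = V" "A \<inter> B = {}"
  shows "degree E x = degree_in E A x + degree_in E B x"
proof -
  have "neighborhood E x = (neighborhood E x \<inter> A) \<union> (neighborhood E x \<inter> B)"
    using neighborhood_subset[OF assms(1)] assms(2) by blast
  then show ?thesis
    using card_Un_disjoint[of "neighborhood E x \<inter> A" "neighborhood E x \<inter> B"]
      finite_neighborhood[OF assms(1)] assms(3)
    by (auto simp: degree_def degree_in_def)
qed

text \<open>A finite set has no proper subset of the same size. This turns a tight degree count into
  membership of individual neighbours.\<close>

lemma neighbors_mem_of_degree_in_le:
  assumes "fin_simple_graph V E" "S \<subseteq> T" "degree_in E T x \<le> degree_in E S x"
    and "y \<in> neighborhood E x" "y \<in> T"
  shows "y \<in> S"
proof -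
  have "neighborhood E x \<inter> S = neighborhood E x \<inter> T"
    using assms(2,3) finite_neighborhood[OF assms(1)]
    by (intro card_seteq) (auto simp: degree_in_def)
  then show ?thesis using assms(4,5) by blast
qed

lemma edges_in_insert:
  assumes "fin_simple_graph V E" "v \<notin> S"
  shows "edges_in E (insert v S) = edges_in E S + degree_in E S v"
proof -
  let ?N = "(\<lambda>u. {v, u}) ` (neighborhood E v \<inter> S)"
  have "{e \<in> E. e \<subseteq> insert v S} = {e \<in> E. e \<subseteq> S} \<union> ?N"
  proof (intro equalityI subsetI)
    fix e assume e: "e \<in> {e \<in> E. e \<subseteq> insert v S}"
    show "e \<in> {e \<in> E. e \<subseteq> S} \<union> ?N"
    proof (cases "v \<in> e")
      case True
      obtain p q where "e = {p, q}" "p \<noteq> q"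
        using e assms(1) by (auto simp: fin_simple_graph_def card_2_iff)
      then obtain u where "e = {v, u}" "u \<noteq> v"
        using True by (metis insert_commute insertE singletonD)
      then show ?thesis using e by (auto simp: neighborhood_def)
    qed (use e in auto)
  qed (auto simp: neighborhood_def)
  moreover have "card ?N = degree_in E S v"
    unfolding degree_in_def using assms(2)
    by (intro card_image) (auto simp: inj_on_def doubleton_eq_iff)
  moreover have "{e \<in> E. e \<subseteq> S} \<inter> ?N = {}"
    using assms(2) by auto
  ultimately show ?thesis
    using finite_edges[OF assms(1)] finite_neighborhood[OF assms(1)]
    by (simp add: edges_in_def card_Un_disjoint)
qed

lemma weight_commute: "weight E a b A B = weight E b a B A"
  by (simp add: weight_def)

lemma admissible_commute: "admissible V E a b A B \<longleftrightarrow> admissible V E b a B A"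
  by (auto simp: admissible_def)

lemma no_good_pair_commute: "no_good_pair V E a b \<longleftrightarrow> no_good_pair V E b a"
  unfolding no_good_pair_def by (subst all_comm) (simp add: Int_commute conj_ac)

text \<open>Only the terms that involve \<open>x\<close> change. The balance is written additively
  because truncated subtraction would lose the sign of the change.\<close>

lemma weight_move:
  assumes "fin_simple_graph V E" "A \<union> B = V" "A \<inter> B = {}" "x \<in> A"
  shows "weight E a b (A - {x}) (insert x B) + degree_in E A x + b x
       = weight E a b A B + degree_in E B x + a x"
proof -
  have fin: "finite A" "finite B" using assms by (auto simp: fin_simple_graph_def)
  have xB: "x \<notin> B" using assms by auto
  have A: "A = insert x (A - {x})" using assms by auto
  have "degree_in E A x = degree_in E (A - {x}) x"
    using degree_in_insert[OF assms(1), of x "A - {x}" x] A not_neighbor_self[OF assms(1)] by simp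
  moreover have "edges_in E A = edges_in E (A - {x}) + degree_in E (A - {x}) x"
    using edges_in_insert[OF assms(1), of x "A - {x}"] A by simp
  moreover have "sum b A = sum b (A - {x}) + b x"
    using fin assms(4) by (simp add: sum.remove)
  ultimately show ?thesis
    using edges_in_insert[OF assms(1) xB] xB fin by (simp add: weight_def)
qed

section \<open>Degeneracy under removal and insertion of a vertex\<close>

lemma degenerate_subset: "degenerate E f S \<Longrightarrow> T \<subseteq> S \<Longrightarrow> degenerate E f T"
  by (auto simp: degenerate_def)

lemma degenerate_small_vertex:
  assumes "degenerate E f S" "S \<noteq> {}"
  obtains x where "x \<in> S" "degree_in E S x < f x"
  using assms by (auto simp: degenerate_def good_def not_le)

lemma good_remove:
  assumes "fin_simple_graph V E" "good E (\<lambda>x. Suc (f x)) S"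
  shows "good E f (S - {v})"
  unfolding good_def
proof
  fix x assume x: "x \<in> S - {v}"
  have "Suc (f x) \<le> degree_in E S x" using assms(2) x by (auto simp: good_def)
  also have "\<dots> \<le> degree_in E (insert v (S - {v})) x"
    by (rule degree_in_mono[OF assms(1)]) auto
  also have "\<dots> \<le> degree_in E (S - {v}) x + 1"
    by (subst degree_in_insert[OF assms(1)]) auto
  finally show "f x \<le> degree_in E (S - {v}) x" by simp
qed

lemma good_Suc_remove_nonempty:
  assumes "fin_simple_graph V E" "good E (\<lambda>x. Suc (f x)) S" "S \<noteq> {}"
  shows "S - {v} \<noteq> {}"
proof
  assume "S - {v} = {}"
  then have S: "S = {v}" using assms(3) by auto
  then have "degree_in E S v = 0"
    using not_neighbor_self[OF assms(1), of v] by (simp add: degree_in_def)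
  then show False using assms(2) S by (auto simp: good_def)
qed

text \<open>Deleting \<open>v\<close> costs every other vertex at most one neighbour, so an
  \<open>(f + 1)\<close>-good part of \<open>insert v S\<close> would leave a non-empty
  \<open>f\<close>-good part of \<open>S\<close>.\<close>

lemma degenerate_insert:
  assumes "fin_simple_graph V E" "degenerate E f S"
  shows "degenerate E (\<lambda>x. Suc (f x)) (insert v S)"
  unfolding degenerate_def
proof (intro allI impI notI)
  fix T assume T: "T \<subseteq> insert v S" "T \<noteq> {}" "good E (\<lambda>x. Suc (f x)) T"
  have "T - {v} \<subseteq> S" using T(1) by auto
  moreover have "good E f (T - {v})" "T - {v} \<noteq> {}"
    by (rule good_remove[OF assms(1) T(3)], rule good_Suc_remove_nonempty[OF assms(1) T(3,2)])
  ultimately show False using assms(2) by (auto simp: degenerate_def)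
qed

lemma degenerate_Suc: "degenerate E f S \<Longrightarrow> degenerate E (\<lambda>x. Suc (f x)) S"
  unfolding degenerate_def good_def by (meson Suc_leD)

section \<open>Good pairs and internal partitions\<close>

lemma no_good_pair_degenerate:
  assumes "no_good_pair V E a b" "A \<union> B = V" "A \<inter> B = {}"
  shows "degenerate E a A \<or> degenerate E b B"
proof (rule ccontr)
  assume "\<not> ?thesis"
  then obtain S T where "S \<subseteq> A" "S \<noteq> {}" "good E a S" "T \<subseteq> B" "T \<noteq> {}" "good E b T"
    by (auto simp: degenerate_def)
  moreover from this have "S \<subseteq> V" "T \<subseteq> V" "S \<inter> T = {}" using assms(2,3) by blast+
  ultimately show False using assms(1) by (auto simp: no_good_pair_def)
qed

lemma internal_partition_of_good_pair:
  assumes G: "fin_simple_graph V E" and deg: "\<forall>x\<in>V. a x + b x \<le> degree E x"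
    and pair: "\<not> no_good_pair V E a b"
  shows "\<exists>A B. internal_partition V E a b A B"
proof -
  obtain S0 T where T: "S0 \<subseteq> V" "T \<subseteq> V" "S0 \<inter> T = {}" "S0 \<noteq> {}" "T \<noteq> {}"
    "good E a S0" "good E b T" using pair by (auto simp: no_good_pair_def)
  \<comment> \<open>Keeping \<open>T\<close> outside while the first set grows makes the complement
    non-empty and leaves the vertices of \<open>T\<close> with enough neighbours there.\<close>
  let ?P = "\<lambda>S. S \<subseteq> V - T \<and> S \<noteq> {} \<and> good E a S"
  have finV: "finite V" using G by (simp add: fin_simple_graph_def)
  have "finite {S. ?P S}" by (rule finite_subset[of _ "Pow V"]) (use finV in auto)
  moreover have "S0 \<in> {S. ?P S}" using T by auto
  then have "{S. ?P S} \<noteq> {}" by (metis empty_iff)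
  ultimately have "\<exists>A\<in>{S. ?P S}. \<forall>S\<in>{S. ?P S}. A \<subseteq> S \<longrightarrow> A = S"
    using finite_has_maximal by meson
  then obtain A where A: "?P A" and maxA: "\<forall>S\<in>{S. ?P S}. A \<subseteq> S \<longrightarrow> A = S"
    by (elim bexE CollectE)
  have "good E b (V - A)"
    unfolding good_def
  proof (rule ballI, rule ccontr)
    fix x assume x: "x \<in> V - A" and low: "\<not> b x \<le> degree_in E (V - A) x"
    have "degree E x = degree_in E A x + degree_in E (V - A) x"
      by (rule degree_in_partition[OF G]) (use A in auto)
    \<comment> \<open>A shortage in the complement forces enough neighbours in \<open>A\<close>, so
      \<open>x\<close> could join \<open>A\<close>, against maximality.\<close>
    then have big: "a x \<le> degree_in E A x" using low deg x by force
    have "x \<notin> T"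
    proof
      assume "x \<in> T"
      then have "b x \<le> degree_in E T x" using T(7) by (auto simp: good_def)
      also have "\<dots> \<le> degree_in E (V - A) x"
        by (rule degree_in_mono[OF G]) (use A T in auto)
      finally show False using low by simp
    qed
    moreover have "good E a (insert x A)"
      unfolding good_def
    proof
      fix u assume "u \<in> insert x A"
      then have "a u \<le> degree_in E A u" using big A by (auto simp: good_def)
      also have "\<dots> \<le> degree_in E (insert x A) u"
        by (rule degree_in_mono[OF G]) auto
      finally show "a u \<le> degree_in E (insert x A) u" .
    qed
    ultimately have "insert x A \<in> {S. ?P S}" using A x by simp
    then have "A = insert x A" using maxA by blast
    then show False using x by auto
  qed
  moreover have "V - A \<noteq> {}" using A T by blast
  ultimately have "internal_partition V E a b A (V - A)"
    using A by (auto simp: internal_partition_def good_def)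
  then show ?thesis by blast
qed

section \<open>Admissible partitions of maximal weight\<close>

lemma admissible_exists:
  assumes G: "fin_simple_graph V E" and "V \<noteq> {}" and deg: "\<forall>x\<in>V. a x + b x \<le> degree E x"
    and np: "no_good_pair V E a b"
  shows "\<exists>A B. admissible V E a b A B"
proof -
  have finV: "finite V" using G by (simp add: fin_simple_graph_def)
  let ?P = "\<lambda>S. S \<subseteq> V \<and> S \<noteq> {} \<and> good E a S"
  have "degree_in E V x = degree E x" for x
    using neighborhood_subset[OF G, of x] by (simp add: degree_in_def degree_def Int_absorb2)
  then have "good E a V" using deg by (force simp: good_def)
  then have "{S. ?P S} \<noteq> {}" using assms(2) by auto
  moreover have "finite {S. ?P S}" by (rule finite_subset[of _ "Pow V"]) (use finV in auto)
  ultimately have "\<exists>A\<in>{S. ?P S}. \<forall>S\<in>{S. ?P S}. S \<subseteq> A \<longrightarrow> A = S"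
    using finite_has_minimal by meson
  then obtain A where A: "?P A" and minA: "\<forall>S\<in>{S. ?P S}. S \<subseteq> A \<longrightarrow> A = S"
    by (elim bexE CollectE)
  have "degenerate E (\<lambda>x. Suc (a x)) A"
    unfolding degenerate_def
  proof (intro allI impI notI)
    fix T assume T: "T \<subseteq> A" "T \<noteq> {}" "good E (\<lambda>x. Suc (a x)) T"
    then obtain v where v: "v \<in> T" by auto
    \<comment> \<open>The slack of one pays for the loss of \<open>v\<close>, giving a smaller
      \<open>a\<close>-good set than the minimal \<open>A\<close>.\<close>
    have "?P (T - {v})"
      using good_remove[OF G T(3)] good_Suc_remove_nonempty[OF G T(3,2)] T(1) A by blast
    moreover have "T - {v} \<subseteq> A" using T(1) by auto
    ultimately have "A = T - {v}" using minA by simp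
    then show False using v T(1) by auto
  qed
  moreover have "degenerate E b (V - A)"
    unfolding degenerate_def
  proof (intro allI impI notI)
    fix T assume T: "T \<subseteq> V - A" "T \<noteq> {}" "good E b T"
    then have "T \<subseteq> V" "A \<inter> T = {}" by auto
    then show False using np A T(2,3) unfolding no_good_pair_def by meson
  qed
  then have "degenerate E (\<lambda>x. Suc (b x)) (V - A)" by (rule degenerate_Suc)
  ultimately have "admissible V E a b A (V - A)"
    using A by (auto simp: admissible_def)
  then show ?thesis by blast
qed

lemma admissible_right_nonempty:
  assumes G: "fin_simple_graph V E" and "V \<noteq> {}" and deg: "\<forall>x\<in>V. a x + b x \<le> degree E x"
    and b: "\<forall>x\<in>V. b x > 0" and adm: "admissible V E a b A B"
  shows "B \<noteq> {}"
proof
  assume "B = {}"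
  then have AV: "A = V" using adm by (auto simp: admissible_def)
  then obtain x where x: "x \<in> V" "degree_in E V x < Suc (a x)"
    using degenerate_small_vertex adm assms(2) unfolding admissible_def by metis
  have "degree_in E V x = degree E x"
    using neighborhood_subset[OF G, of x] by (simp add: degree_in_def degree_def Int_absorb2)
  then show False using x deg b by fastforce
qed

text \<open>Since \<open>y\<close> has a shortage in \<open>B\<close>, the degree condition gives it
  a surplus in \<open>A\<close>, so moving it raises the weight. By maximality the move breaks
  admissibility, and only the side that gains \<open>y\<close> can be at fault.\<close>

lemma admissible_blocked:
  assumes G: "fin_simple_graph V E" and deg: "\<forall>x\<in>V. a x + b x \<le> degree E x"
    and adm: "admissible V E a b A B"
    and max: "\<And>A' B'. admissible V E a b A' B' \<Longrightarrow> weight E a b A' B' \<le> weight E a b A B"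
    and y: "y \<in> B" "degree_in E B y < b y"
  shows "\<exists>S\<subseteq>insert y A. S \<noteq> {} \<and> good E (\<lambda>x. Suc (a x)) S"
proof (rule ccontr)
  assume "\<not> ?thesis"
  then have "degenerate E (\<lambda>x. Suc (a x)) (insert y A)" by (auto simp: degenerate_def)
  moreover have "degenerate E (\<lambda>x. Suc (b x)) (B - {y})"
    using adm by (auto simp: admissible_def intro: degenerate_subset)
  moreover have part: "A \<union> B = V" "A \<inter> B = {}" using adm by (auto simp: admissible_def)
  ultimately have "admissible V E a b (insert y A) (B - {y})"
    using y(1) by (auto simp: admissible_def)
  then have "weight E a b (insert y A) (B - {y}) \<le> weight E a b A B" by (rule max)
  moreover have "weight E b a (B - {y}) (insert y A) + degree_in E B y + a y
       = weight E b a B A + degree_in E A y + b y"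
    using part y(1) by (intro weight_move[OF G]) auto
  moreover have "y \<in> V" using y(1) part by auto
  then have "a y + b y \<le> degree_in E A y + degree_in E B y"
    using degree_in_partition[OF G part, of y] deg by fastforce
  ultimately show False
    using y(2) by (simp add: weight_commute[of E a b])
qed

text \<open>Two triangles on the edge \<open>{p, q}\<close> with different apexes would span five
  edges on four vertices.\<close>

lemma triangles_share_no_edge:
  assumes G: "fin_simple_graph V E" and sp: "four_sparse V E"
    and "q \<in> neighborhood E p" "r \<in> neighborhood E p" "r \<in> neighborhood E q"
    and "s \<in> neighborhood E p" "s \<in> neighborhood E q"
  shows "r = s"
proof (rule ccontr)
  assume rs: "r \<noteq> s"
  have d: "p \<noteq> q" "p \<noteq> r" "q \<noteq> r" "p \<noteq> s" "q \<noteq> s"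
    using assms not_neighbor_self[OF G] by blast+
  let ?S = "{p, q, r, s}"
  let ?F = "{{p, q}, {p, r}, {q, r}, {p, s}, {q, s}}"
  have "p \<in> V"
    using assms(3) neighborhood_subset[OF G, of q] by (auto simp: neighborhood_sym[of q E p])
  then have "?S \<subseteq> V" using assms neighborhood_subset[OF G] by blast
  moreover have "card ?S = 4" using d rs by simp
  ultimately have "card {e \<in> E. e \<subseteq> ?S} \<le> 4" using sp unfolding four_sparse_def by blast
  moreover have "?F \<subseteq> {e \<in> E. e \<subseteq> ?S}" using assms by (auto simp: neighborhood_def)
  then have "card ?F \<le> card {e \<in> E. e \<subseteq> ?S}"
    by (rule card_mono[rotated]) (simp add: finite_edges[OF G])
  moreover have "card ?F = 5" using d rs by (simp add: doubleton_eq_iff)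
  ultimately show False by simp
qed

section \<open>Contradiction from a maximal admissible partition\<close>

lemma maximal_admissible_contradiction:
  assumes G: "fin_simple_graph V E" and ne: "V \<noteq> {}" and sp: "four_sparse V E"
    and a: "\<forall>x\<in>V. 2 \<le> a x" and b: "\<forall>x\<in>V. 2 \<le> b x"
    and deg: "\<forall>x\<in>V. a x + b x \<le> degree E x"
    and np: "no_good_pair V E a b"
    and adm0: "admissible V E a b A0 B0"
    and max0: "\<And>A' B'. admissible V E a b A' B' \<Longrightarrow> weight E a b A' B' \<le> weight E a b A0 B0"
    and dB0: "degenerate E b B0"
  shows False
proof -
  define P where "P = (\<lambda>(A, B). admissible V E a b A B \<and> degenerate E b B \<and>
    weight E a b A B = weight E a b A0 B0)"
  have "P (A0, B0)" using adm0 dB0 by (simp add: P_def)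
  from ex_has_least_nat[of P, OF this, of "\<lambda>(A, B). card A"]
  obtain A B where PAB: "P (A, B)" and min: "\<And>A' B'. P (A', B') \<Longrightarrow> card A \<le> card A'"
    by auto
  have adm: "admissible V E a b A B" and dB: "degenerate E b B"
    and wAB: "weight E a b A B = weight E a b A0 B0" using PAB by (auto simp: P_def)
  have max: "weight E a b A' B' \<le> weight E a b A B" if "admissible V E a b A' B'" for A' B'
    using max0[OF that] wAB by simp
  have part: "A \<union> B = V" "A \<inter> B = {}" and dA: "degenerate E (\<lambda>x. Suc (a x)) A"
    using adm by (auto simp: admissible_def)
  have finA: "finite A" using G part by (auto simp: fin_simple_graph_def)
  have Bne: "B \<noteq> {}"
    by (rule admissible_right_nonempty[OF G ne deg _ adm]) (use b in force)
  have deg': "\<forall>x\<in>V. b x + a x \<le> degree E x" using deg by (simp add: add.commute)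
  have Ane: "A \<noteq> {}"
    by (rule admissible_right_nonempty[OF G ne deg', of B])
      (use a adm in \<open>force simp: admissible_commute[of V E b a]\<close>)+
  obtain x where x: "x \<in> A" "degree_in E A x < Suc (a x)"
    using degenerate_small_vertex[OF dA Ane] .
  define A1 B1 where "A1 = A - {x}" and "B1 = insert x B"
  have xB: "x \<notin> B" and xV: "x \<in> V" using x part by auto
  have adm1: "admissible V E a b A1 B1"
    using part x(1) dA degenerate_insert[OF G dB, of x] degenerate_subset[OF dA, of A1]
    by (auto simp: admissible_def A1_def B1_def)
  have wmove: "weight E a b A1 B1 + degree_in E A x + b x = weight E a b A B + degree_in E B x + a x"
    unfolding A1_def B1_def by (rule weight_move[OF G part x(1)])
  have sumx: "a x + b x \<le> degree_in E A x + degree_in E B x"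
    using degree_in_partition[OF G part, of x] bspec[OF deg xV] by simp
  \<comment> \<open>From \<open>degree_in E A x \<le> a x\<close> the surplus of \<open>x\<close> in
    \<open>B\<close> is at least 0, so the move cannot lower the weight; maximality then makes both
    surpluses exactly 0.\<close>
  have dAx: "degree_in E A x = a x" and dBx: "degree_in E B x = b x"
    and w1: "weight E a b A1 B1 = weight E a b A B"
    using wmove sumx x(2) max[OF adm1] by linarith+
  have "\<not> degenerate E b B1"
  proof
    assume "degenerate E b B1"
    then have "P (A1, B1)" using adm1 w1 wAB by (simp add: P_def)
    then have "card A \<le> card A1" by (rule min)
    then show False using x(1) finA card_Diff1_less[of A x] by (simp add: A1_def)
  qed
  moreover have part1: "A1 \<union> B1 = V" "A1 \<inter> B1 = {}" using adm1 by (auto simp: admissible_def)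
  ultimately have dA1: "degenerate E a A1"
    using no_good_pair_degenerate[OF np] by blast
  have "A1 \<noteq> {}"
  proof
    assume "A1 = {}"
    then have "A = {x}" using x(1) by (auto simp: A1_def)
    then have "degree_in E A x = 0"
      using not_neighbor_self[OF G, of x] by (simp add: degree_in_def)
    then show False using dAx a xV by force
  qed
  then obtain z where z: "z \<in> A1" "degree_in E A1 z < a z"
    using degenerate_small_vertex[OF dA1] by blast
  have zB1: "z \<notin> B1" "z \<notin> B" using z(1) part1 by (auto simp: B1_def)
  have max1: "weight E b a A' B' \<le> weight E b a B1 A1" if "admissible V E b a A' B'" for A' B'
    using max[of B' A'] that w1 by (simp add: admissible_commute[of V E b a] weight_commute[of E b a])
  \<comment> \<open>The blocking lemma is used with the sides exchanged: \<open>z\<close> tries to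
    leave \<open>A1\<close> for \<open>B1\<close>.\<close>
  have "\<exists>T\<subseteq>insert z B1. T \<noteq> {} \<and> good E (\<lambda>x. Suc (b x)) T"
    using adm1 z max1
    by (intro admissible_blocked[OF G deg', of B1 A1 z]) (auto simp: admissible_commute[of V E b a])
  then obtain T where T: "T \<subseteq> insert z B1" "T \<noteq> {}" "good E (\<lambda>x. Suc (b x)) T" by blast
  have Tdeg: "Suc (b u) \<le> degree_in E T u" if "u \<in> T" for u
    using T(3) that by (auto simp: good_def)
  have Tle: "degree_in E T u \<le> degree_in E (insert z B1) u" for u
    by (rule degree_in_mono[OF G T(1)])
  have big: "degree_in E (insert z B1) u = degree_in E B u
      + (if x \<in> neighborhood E u then 1 else 0) + (if z \<in> neighborhood E u then 1 else 0)" for u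
    using degree_in_insert[OF G zB1(1), of u] degree_in_insert[OF G xB, of u]
    by (simp add: B1_def)
  have xT: "x \<in> T"
  proof (rule ccontr)
    assume "x \<notin> T"
    then have "T - {z} \<subseteq> B" using T(1) by (auto simp: B1_def)
    then show False
      using dB good_remove[OF G T(3), of z] good_Suc_remove_nonempty[OF G T(3,2), of z]
      by (auto simp: degenerate_def)
  qed
  \<comment> \<open>\<open>T\<close> demands \<open>b x + 1\<close> neighbours of \<open>x\<close>,
    but \<open>B\<close> supplies exactly \<open>b x\<close>, so \<open>z\<close> must be one
    more.\<close>
  have xz: "z \<in> neighborhood E x"
    using Tdeg[OF xT] Tle[of x] big[of x] dBx not_neighbor_self[OF G, of x]
    by (auto split: if_splits)
  \<comment> \<open>The count at \<open>x\<close> is now tight, so \<open>T\<close> contains every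
    neighbour of \<open>x\<close> in \<open>B\<close>.\<close>
  have BT: "u \<in> T" if "u \<in> neighborhood E x" "u \<in> B" for u
  proof (rule neighbors_mem_of_degree_in_le[OF G T(1) _ that(1)])
    show "degree_in E (insert z B1) x \<le> degree_in E T x"
      using Tdeg[OF xT] big[of x] dBx xz not_neighbor_self[OF G, of x] by simp
    show "u \<in> insert z B1" using that by (auto simp: B1_def)
  qed
  \<comment> \<open>The set blocking \<open>y\<close> must contain \<open>x\<close>, whose degree in
    \<open>A\<close> is only \<open>a x\<close>; hence \<open>y\<close> is adjacent to
    \<open>x\<close> and lies in \<open>T\<close>. Its shortage in \<open>B\<close> then requires
    both \<open>x\<close> and \<open>z\<close> as neighbours.\<close>
  have low: "y \<in> T \<and> x \<in> neighborhood E y \<and> z \<in> neighborhood E y"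
    if y: "y \<in> B" "degree_in E B y < b y" for y
  proof -
    obtain S where S: "S \<subseteq> insert y A" "S \<noteq> {}" "good E (\<lambda>x. Suc (a x)) S"
      using admissible_blocked[OF G deg adm max y] by blast
    have yA: "y \<notin> A" using y part by auto
    have "x \<in> S"
    proof (rule ccontr)
      assume "x \<notin> S"
      then have "S - {y} \<subseteq> A1" using S(1) by (auto simp: A1_def)
      then show False
        using dA1 good_remove[OF G S(3), of y] good_Suc_remove_nonempty[OF G S(3,2), of y]
        by (auto simp: degenerate_def)
    qed
    then have "Suc (a x) \<le> degree_in E S x" using S(3) by (auto simp: good_def)
    also have "\<dots> \<le> degree_in E (insert y A) x" by (rule degree_in_mono[OF G S(1)])
    finally have yx: "y \<in> neighborhood E x"
      using degree_in_insert[OF G yA, of x] dAx by (auto split: if_splits)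
    then have yT: "y \<in> T" using BT y(1) by blast
    then have "z \<in> neighborhood E y"
      using Tdeg[OF yT] Tle[of y] big[of y] y(2) by (auto split: if_splits)
    then show ?thesis using yT yx by (simp add: neighborhood_sym[of x])
  qed
  obtain y where y: "y \<in> B" "degree_in E B y < b y"
    using degenerate_small_vertex[OF dB Bne] .
  have yT: "y \<in> T" and yx: "x \<in> neighborhood E y" and yz: "z \<in> neighborhood E y"
    using low[OF y] by auto
  \<comment> \<open>At most two neighbours, \<open>x\<close> and \<open>z\<close>, come from outside
    \<open>B\<close>, so the shortage of \<open>y\<close> is exactly one and its count in
    \<open>T\<close> is tight.\<close>
  have dBy: "Suc (degree_in E B y) = b y"
    using Tdeg[OF yT] Tle[of y] big[of y] y(2) yx yz by simp
  have By: "B = insert y (B - {y})" using y by auto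
  have "B - {y} \<noteq> {}"
  proof
    assume "B - {y} = {}"
    then have "B = {y}" using y by auto
    then have "degree_in E B y = 0"
      using not_neighbor_self[OF G, of y] by (simp add: degree_in_def)
    then show False using dBy b y part by force
  qed
  then obtain y' where y': "y' \<in> B - {y}" "degree_in E (B - {y}) y' < b y'"
    using degenerate_small_vertex[OF degenerate_subset[OF dB, of "B - {y}"]] by blast
  have dBy': "degree_in E B y' = degree_in E (B - {y}) y' + (if y \<in> neighborhood E y' then 1 else 0)"
    using degree_in_insert[OF G, of y "B - {y}" y'] By by simp
  have distinct: "y' \<noteq> x" "y' \<noteq> y" "y' \<noteq> z" using y' xB zB1 by auto
  show False
  \<comment> \<open>If \<open>y'\<close> is already short in \<open>B\<close>, it forms a second
    triangle on the edge \<open>x z\<close>. Otherwise it is adjacent to \<open>y\<close> and has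
    exactly \<open>b y'\<close> neighbours in \<open>B\<close>; being in \<open>T\<close> it needs
    \<open>x\<close> or \<open>z\<close> too, which gives a second triangle on \<open>y x\<close> or
    \<open>y z\<close>.\<close>
  proof (cases "degree_in E B y' < b y'")
    case True
    then have "x \<in> neighborhood E y'" "z \<in> neighborhood E y'"
      using low[of y'] y' by auto
    then show False
      using triangles_share_no_edge[OF G sp xz, of y y'] yx yz distinct
      by (simp add: neighborhood_sym[of _ E x] neighborhood_sym[of _ E z])
  next
    case False
    then have yy': "y \<in> neighborhood E y'" and dle: "degree_in E B y' \<le> b y'"
      using dBy' y'(2) by (auto split: if_splits)
    have y'T: "y' \<in> T"
    proof (rule neighbors_mem_of_degree_in_le[OF G T(1), of y])
      show "degree_in E (insert z B1) y \<le> degree_in E T y"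
        using Tdeg[OF yT] big[of y] dBy yx yz by simp
      show "y' \<in> neighborhood E y" using yy' by (simp add: neighborhood_sym[of y])
      show "y' \<in> insert z B1" using y' by (auto simp: B1_def)
    qed
    then have "x \<in> neighborhood E y' \<or> z \<in> neighborhood E y'"
      using Tdeg[OF y'T] Tle[of y'] big[of y'] dle by (auto split: if_splits)
    then show False
    proof
      assume "x \<in> neighborhood E y'"
      then show False
        using triangles_share_no_edge[OF G sp yx, of z y'] yz xz yy' distinct
        by (simp add: neighborhood_sym[of y' E])
    next
      assume "z \<in> neighborhood E y'"
      then show False
        using triangles_share_no_edge[OF G sp yz, of x y'] yx xz yy' distinct
        by (simp add: neighborhood_sym[of y' E] neighborhood_sym[of x E z])
    qed
  qed
qed

theorem theorem2:
  fixes V :: "'a set" and E :: "'a set set" and a b :: "'a \<Rightarrow> nat"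
  assumes "fin_simple_graph V E"
    and "V \<noteq> {}"
    and "four_sparse V E"
    and "\<forall>x\<in>V. a x \<ge> 2"
    and "\<forall>x\<in>V. b x \<ge> 2"
    and "\<forall>x\<in>V. degree E x \<ge> a x + b x"
  shows "\<exists>A B. internal_partition V E a b A B"
proof (cases "no_good_pair V E a b")
  case False
  then show ?thesis using internal_partition_of_good_pair assms(1,6) by blast
next
  case True
  define W where "W = (\<lambda>(A, B). weight E a b A B) ` {(A, B). admissible V E a b A B}"
  have "finite (Pow V \<times> Pow V)" using assms(1) by (simp add: fin_simple_graph_def)
  then have "finite {(A, B). admissible V E a b A B}"
    by (rule finite_subset[rotated]) (auto simp: admissible_def)
  then have finW: "finite W" by (simp add: W_def)
  have "W \<noteq> {}" using admissible_exists[OF assms(1,2,6) True] by (auto simp: W_def)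
  then have "Max W \<in> W" using finW by simp
  then obtain A B where adm: "admissible V E a b A B" and w: "weight E a b A B = Max W"
    by (auto simp: W_def)
  have max: "weight E a b A' B' \<le> weight E a b A B" if "admissible V E a b A' B'" for A' B'
    unfolding w using that by (intro Max_ge[OF finW]) (auto simp: W_def)
  have "degenerate E a A \<or> degenerate E b B"
    using no_good_pair_degenerate[OF True] adm by (auto simp: admissible_def)
  then have False
  proof
    \<comment> \<open>Exchanging \<open>a\<close> with \<open>b\<close> and \<open>A\<close> with
      \<open>B\<close> preserves admissibility and weight, so this case reduces to the
      other.\<close>
    assume dA: "degenerate E a A"
    have "no_good_pair V E b a" using True no_good_pair_commute by blast
    moreover have "\<forall>x\<in>V. b x + a x \<le> degree E x" using assms(6) by (simp add: add.commute)
    moreover have "admissible V E b a B A" using adm admissible_commute by blast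
    moreover have "weight E b a A' B' \<le> weight E b a B A" if "admissible V E b a A' B'" for A' B'
      using max[of B' A'] that by (simp add: admissible_commute[of V E b a] weight_commute[of E b a])
    ultimately show False
      using maximal_admissible_contradiction[OF assms(1-3,5,4) _ _ _ _ dA] by blast
  next
    assume "degenerate E b B"
    then show False
      using maximal_admissible_contradiction[OF assms(1-6) True adm max] by blast
  qed
  then show ?thesis ..
qed

end
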